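(* Let $a<b$ be real numbers and let $f:[a,b]\rightarrow\mathbb{R}$ be continuous on $[a,b]$ and twice differentiable on $(a,b)$, with second derivative $f'':(a,b)\rightarrow\mathbb{R}$ belonging to $L_1(a,b)$. Let $I_n: a=x_0<x_1<\dots<x_{n-1}<x_n=b$ be a division of $[a,b]$ and let $h_i=x_{i+1}-x_i$ for $i=0,1,\dots,n-1$. Then $$\int_a^bf(x)\,dx=M(f,f',I_n)+R_M(f,f',I_n),$$ where $$M(f,f',I_n)=\sum_{i=0}^{n-1}h_if\left(\frac{x_i+x_{i+1}}{2}\right)$$ and the remainder term $R_M(f,f',I_n)$ satisfies $$\left|R_M(f,f',I_n)\right|\leq\|f''\|_1\sum_{i=0}^{n-1}\frac{h_i^2}{8}.$$
   Context: Here $\|f''\|_1=\int_a^b|f''(t)|\,dt$, taken over the whole interval $(a,b)$. *)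

theory Defs
  imports "HOL-Analysis.Analysis"
begin

text \<open>A division with \<open>n\<close> subintervals is given by its nodes \<open>x 0, \<dots>, x n\<close>;
  the values of \<open>x\<close> beyond \<open>n\<close> are irrelevant.\<close>

definition is_division :: "real \<Rightarrow> real \<Rightarrow> nat \<Rightarrow> (nat \<Rightarrow> real) \<Rightarrow> bool" where
  "is_division a b n x \<longleftrightarrow> x 0 = a \<and> x n = b \<and> (\<forall>i<n. x i < x (Suc i))"

definition step :: "(nat \<Rightarrow> real) \<Rightarrow> nat \<Rightarrow> real" where
  "step x i = x (Suc i) - x i"

definition midpoint_rule :: "(real \<Rightarrow> real) \<Rightarrow> nat \<Rightarrow> (nat \<Rightarrow> real) \<Rightarrow> real" where
  "midpoint_rule f n x = (\<Sum>i<n. step x i * f ((x i + x (Suc i)) / 2))"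

definition midpoint_remainder :: "(real \<Rightarrow> real) \<Rightarrow> nat \<Rightarrow> (nat \<Rightarrow> real) \<Rightarrow> real" where
  "midpoint_remainder f n x = integral {x 0..x n} f - midpoint_rule f n x"

end

theory Submission
  imports Defs
begin

text \<open>
  Fix a subinterval \<open>[c, d]\<close> of length \<open>h\<close> with midpoint \<open>m\<close>. Folding it at \<open>m\<close>, its error
  in the midpoint rule is the integral over \<open>0 \<le> s \<le> h/2\<close> of the second symmetric
  difference \<open>f (m + s) + f (m - s) - 2 * f m\<close>. By the mean value theorem this difference
  equals \<open>s * (f' (m + z) - f' (m - z))\<close> for some \<open>z < s\<close>, so if \<open>f'\<close> oscillates by at most
  \<open>K\<close> the error is at most the integral of \<open>K * s\<close>, that is \<open>K * h\<^sup>2 / 8\<close>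
  (lemma \<open>midpoint_error_le_oscillation\<close>).

  The fundamental theorem of calculus for \<open>f'\<close> bounds its oscillation by the \<open>L\<^sub>1\<close> norm of
  \<open>f''\<close> (lemma \<open>derivative_oscillation_le_L1_norm\<close>), and summing over the division gives the
  estimate. Estimating \<open>f t - f m - f' m * (t - m)\<close> on the two halves separately by
  \<open>K * \<bar>t - m\<bar>\<close> would give only \<open>K * h\<^sup>2 / 4\<close>. Folding compares \<open>f'\<close> just once, between
  mirrored points, and this is what yields the constant \<open>1/8\<close>.
\<close>

text \<open>
  Differentiability is assumed on the open interval only, so that the lemma applies to
  subintervals touching an end point of the domain, where \<open>f\<close> is merely continuous. The
  mean value theorem, applied to \<open>s \<mapsto> f (m + s) + f (m - s)\<close>, tolerates this.
\<close>

lemma symmetric_difference_bound: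
  fixes f f' :: "real \<Rightarrow> real"
  assumes "0 \<le> s" "s \<le> r" and cont: "continuous_on {m - r..m + r} f"
    and der: "\<And>t. t \<in> {m - r<..<m + r} \<Longrightarrow> (f has_real_derivative f' t) (at t)"
    and osc: "\<And>u v. m - r < v \<Longrightarrow> v < u \<Longrightarrow> u < m + r \<Longrightarrow> \<bar>f' u - f' v\<bar> \<le> K"
  shows "\<bar>f (m + s) + f (m - s) - 2 * f m\<bar> \<le> K * s"
proof (cases "s = 0")
  case True
  then show ?thesis by simp
next
  case False
  with \<open>0 \<le> s\<close> have "0 < s" by simp
  let ?g = "\<lambda>s. f (m + s) + f (m - s)"
  have "continuous_on {0..s} ?g"
    using \<open>s \<le> r\<close>
    by (intro continuous_intros continuous_on_compose2[OF cont]) auto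
  moreover have g': "(?g has_real_derivative f' (m + t) - f' (m - t)) (at t)"
    if "0 < t" "t < s" for t
  proof -
    have "((\<lambda>s. f (m + s)) has_real_derivative f' (m + t) * 1) (at t)"
      using that \<open>s \<le> r\<close> by (intro DERIV_chain2[OF der]) (auto intro!: derivative_eq_intros)
    moreover have "((\<lambda>s. f (m - s)) has_real_derivative f' (m - t) * -1) (at t)"
      using that \<open>s \<le> r\<close> by (intro DERIV_chain2[OF der]) (auto intro!: derivative_eq_intros)
    ultimately show ?thesis
      using DERIV_add by fastforce
  qed
  ultimately have "\<exists>l z. 0 < z \<and> z < s \<and> (?g has_real_derivative l) (at z) \<and> ?g s - ?g 0 = (s - 0) * l"
    using \<open>0 < s\<close> by (intro MVT) (auto simp: real_differentiable_def)
  then obtain l z where z: "0 < z" "z < s"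
    and l: "(?g has_real_derivative l) (at z)" and mvt: "?g s - ?g 0 = (s - 0) * l"
    by blast
  have "l = f' (m + z) - f' (m - z)"
    using DERIV_unique[OF l g'[OF z]] .
  with z \<open>s \<le> r\<close> have "\<bar>l\<bar> \<le> K"
    using osc[of "m - z" "m + z"] by simp
  with \<open>0 < s\<close> have "\<bar>s * l\<bar> \<le> K * s"
    by (simp add: abs_mult mult.commute)
  moreover have "f (m + s) + f (m - s) - 2 * f m = s * l"
    using mvt by simp
  ultimately show ?thesis
    by simp
qed

text \<open>
  The folding is done on the level of primitives, which avoids a substitution in the
  integral: with \<open>F\<close> a primitive of \<open>f\<close>, the function
  \<open>\<Phi> s = F (m + s) - F (m - s) - 2 * s * f m\<close> is the midpoint error on \<open>[m - s, m + s]\<close>,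
  and its derivative is the second symmetric difference.
\<close>

lemma midpoint_error_le_oscillation:
  fixes f f' :: "real \<Rightarrow> real"
  assumes "c < d" and cont: "continuous_on {c..d} f"
    and der: "\<And>t. t \<in> {c<..<d} \<Longrightarrow> (f has_real_derivative f' t) (at t)"
    and osc: "\<And>u v. c < v \<Longrightarrow> v < u \<Longrightarrow> u < d \<Longrightarrow> \<bar>f' u - f' v\<bar> \<le> K"
  shows "\<bar>integral {c..d} f - (d - c) * f ((c + d) / 2)\<bar> \<le> K * (d - c)\<^sup>2 / 8"
proof -
  define m where "m = (c + d) / 2"
  define r where "r = (d - c) / 2"
  have c: "c = m - r" and d: "d = m + r" and "0 < r"
    using \<open>c < d\<close> by (auto simp: m_def r_def field_simps)
  define F where "F u = integral {c..u} f" for u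
  define \<Phi> where "\<Phi> s = F (m + s) - F (m - s) - 2 * s * f m" for s
  have F': "(F has_real_derivative f u) (at u)" if "u \<in> {c<..<d}" for u
  proof -
    have "(F has_real_derivative f u) (at u within {c..d})"
      using integral_has_real_derivative[OF cont, of u] that by (simp add: F_def[abs_def])
    then show ?thesis
      using that by (simp add: at_within_Icc_at)
  qed
  have contF: "continuous_on {c..d} F"
    unfolding F_def
    by (intro indefinite_integral_continuous_1 integrable_continuous_real cont)
  have contPhi: "continuous_on {0..r} \<Phi>"
    unfolding \<Phi>_def
    by (intro continuous_intros continuous_on_compose2[OF contF]) (auto simp: c d)
  have Phi': "(\<Phi> has_real_derivative f (m + s) + f (m - s) - 2 * f m) (at s)"
    if "s \<in> {0<..<r}" for s
  proof -
    have right: "((\<lambda>s. F (m + s)) has_real_derivative f (m + s) * 1) (at s)"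
      using that by (intro DERIV_chain2[OF F']) (auto simp: c d intro!: derivative_eq_intros)
    have left: "((\<lambda>s. F (m - s)) has_real_derivative f (m - s) * -1) (at s)"
      using that by (intro DERIV_chain2[OF F']) (auto simp: c d intro!: derivative_eq_intros)
    have linear: "((\<lambda>s. 2 * s * f m) has_real_derivative 2 * f m) (at s)"
      by (auto intro!: derivative_eq_intros)
    show ?thesis
      unfolding \<Phi>_def using DERIV_diff[OF DERIV_diff[OF right left] linear] by simp
  qed
  have lhs: "((\<lambda>s. f (m + s) + f (m - s) - 2 * f m) has_integral \<Phi> r - \<Phi> 0) {0..r}"
    using \<open>0 < r\<close> contPhi Phi'
    by (intro fundamental_theorem_of_calculus_interior)
       (auto simp flip: has_real_derivative_iff_has_vector_derivative)
  have rhs: "((\<lambda>s. K * s) has_integral K * r\<^sup>2 / 2 - K * 0\<^sup>2 / 2) {0..r}"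
    using \<open>0 < r\<close>
    by (intro fundamental_theorem_of_calculus)
       (auto simp flip: has_real_derivative_iff_has_vector_derivative
             intro!: derivative_eq_intros)
  have "\<bar>f (m + s) + f (m - s) - 2 * f m\<bar> \<le> K * s" if "s \<in> {0..r}" for s
    using symmetric_difference_bound[of s r m f f' K] that cont der osc by (simp add: c d)
  then have "\<bar>\<Phi> r - \<Phi> 0\<bar> \<le> K * r\<^sup>2 / 2"
    using integral_norm_bound_integral[OF has_integral_integrable[OF lhs] has_integral_integrable[OF rhs]]
    unfolding integral_unique[OF lhs] integral_unique[OF rhs] by simp
  moreover have "\<Phi> r - \<Phi> 0 = integral {c..d} f - (d - c) * f m"
    by (simp add: \<Phi>_def F_def c d)
  moreover have "K * r\<^sup>2 / 2 = K * (d - c)\<^sup>2 / 8"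
    by (simp add: r_def power_divide)
  ultimately show ?thesis
    by (simp add: m_def)
qed

text \<open>
  The derivative \<open>g'\<close> need not be continuous, but the gauge integral recovers \<open>g\<close> from any
  everywhere defined derivative. The proof therefore works with gauge integrals; Lebesgue
  integrability enters through \<open>\<bar>g'\<bar>\<close>, on which the two integrals agree.
\<close>

lemma derivative_oscillation_le_L1_norm:
  fixes g g' :: "real \<Rightarrow> real"
  assumes der: "\<And>t. t \<in> {a<..<b} \<Longrightarrow> (g has_real_derivative g' t) (at t)"
    and int: "set_integrable lebesgue {a<..<b} g'"
    and "a < v" "v < u" "u < b"
  shows "\<bar>g u - g v\<bar> \<le> (LINT t:{a<..<b}|lebesgue. \<bar>g' t\<bar>)"
proof -
  have abs_int: "set_integrable lebesgue {a<..<b} (\<lambda>t. \<bar>g' t\<bar>)"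
    using set_integrable_abs[OF int] .
  then have int_ab: "(\<lambda>t. \<bar>g' t\<bar>) integrable_on {a<..<b}"
    and L1: "(LINT t:{a<..<b}|lebesgue. \<bar>g' t\<bar>) = integral {a<..<b} (\<lambda>t. \<bar>g' t\<bar>)"
    using set_lebesgue_integral_eq_integral by auto
  have sub: "{v..u} \<subseteq> {a<..<b}"
    using \<open>a < v\<close> \<open>u < b\<close> by auto
  have int_vu: "(\<lambda>t. \<bar>g' t\<bar>) integrable_on {v..u}"
    using set_lebesgue_integral_eq_integral(1)[OF set_integrable_subset[OF abs_int _ sub]] by simp
  have "(g has_vector_derivative g' t) (at t within {v..u})" if "t \<in> {v..u}" for t
    using has_field_derivative_at_within[OF der, of t "{v..u}"] sub that
    by (auto simp: has_real_derivative_iff_has_vector_derivative)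
  then have "(g' has_integral g u - g v) {v..u}"
    using \<open>v < u\<close> by (intro fundamental_theorem_of_calculus) auto
  then have "\<bar>g u - g v\<bar> \<le> integral {v..u} (\<lambda>t. \<bar>g' t\<bar>)"
    using integral_norm_bound_integral[of g' "{v..u}" "\<lambda>t. \<bar>g' t\<bar>"] int_vu
    by (auto simp: integral_unique has_integral_integrable)
  also have "\<dots> \<le> integral {a<..<b} (\<lambda>t. \<bar>g' t\<bar>)"
    using integral_subset_le[OF sub int_vu int_ab] by simp
  finally show ?thesis
    by (simp add: L1)
qed

lemma is_division_mono:
  assumes "is_division a b n x" "i \<le> j" "j \<le> n"
  shows "x i \<le> x j"
  using assms(2,3)
proof (induction j rule: dec_induct)
  case (step k)
  moreover have "x k < x (Suc k)"
    using assms(1) step by (simp add: is_division_def)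
  ultimately show ?case by simp
qed simp

lemma integral_division_sum:
  fixes f :: "real \<Rightarrow> real"
  assumes div: "is_division a b n x" and int: "f integrable_on {a..b}" and "k \<le> n"
  shows "integral {x 0..x k} f = (\<Sum>i<k. integral {x i..x (Suc i)} f)"
  using \<open>k \<le> n\<close>
proof (induction k)
  case (Suc k)
  have ends: "x 0 = a" "x n = b"
    using div by (auto simp: is_division_def)
  have mono: "x 0 \<le> x k" "x k \<le> x (Suc k)" "x (Suc k) \<le> x n"
    using is_division_mono[OF div] Suc.prems by auto
  then have "f integrable_on {x 0..x (Suc k)}"
    using integrable_subinterval_real[OF int] ends by auto
  then have "integral {x 0..x k} f + integral {x k..x (Suc k)} f = integral {x 0..x (Suc k)} f"
    using mono by (intro Henstock_Kurzweil_Integration.integral_combine) auto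
  with Suc show ?case by simp
qed simp

theorem corollary10:
  fixes a b :: real and f f' f'' :: "real \<Rightarrow> real"
    and n :: nat and x :: "nat \<Rightarrow> real"
  assumes "a < b"
    and "continuous_on {a..b} f"
    and "\<And>t. t \<in> {a<..<b} \<Longrightarrow> (f has_real_derivative f' t) (at t)"
    and "\<And>t. t \<in> {a<..<b} \<Longrightarrow> (f' has_real_derivative f'' t) (at t)"
    and "set_integrable lebesgue {a<..<b} f''"
    and "is_division a b n x"
  shows "(f has_integral (midpoint_rule f n x + midpoint_remainder f n x)) {a..b} \<and>
    \<bar>midpoint_remainder f n x\<bar>
      \<le> (LINT t:{a<..<b}|lebesgue. \<bar>f'' t\<bar>) * (\<Sum>i<n. (step x i)\<^sup>2 / 8)"
proof
  define K where "K = (LINT t:{a<..<b}|lebesgue. \<bar>f'' t\<bar>)"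
  have ends: "x 0 = a" "x n = b"
    using assms(6) by (auto simp: is_division_def)
  have int: "f integrable_on {a..b}"
    using assms(2) by (rule integrable_continuous_real)
  then show "(f has_integral (midpoint_rule f n x + midpoint_remainder f n x)) {a..b}"
    by (simp add: midpoint_remainder_def ends integrable_integral)
  have piece: "\<bar>integral {x i..x (Suc i)} f - step x i * f ((x i + x (Suc i)) / 2)\<bar>
      \<le> K * ((step x i)\<^sup>2 / 8)" if "i < n" for i
  proof -
    have lt: "x i < x (Suc i)"
      using assms(6) that by (simp add: is_division_def)
    have le: "a \<le> x i" "x (Suc i) \<le> b"
      using is_division_mono[OF assms(6), of 0 i] is_division_mono[OF assms(6), of "Suc i" n]
        that ends by auto
    have "\<bar>integral {x i..x (Suc i)} f - (x (Suc i) - x i) * f ((x i + x (Suc i)) / 2)\<bar>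
        \<le> K * (x (Suc i) - x i)\<^sup>2 / 8"
    proof (rule midpoint_error_le_oscillation[OF lt])
      show "continuous_on {x i..x (Suc i)} f"
        using assms(2) le by (auto intro: continuous_on_subset)
      show "(f has_real_derivative f' t) (at t)" if "t \<in> {x i<..<x (Suc i)}" for t
        using assms(3) that le by auto
      show "\<bar>f' u - f' v\<bar> \<le> K" if "x i < v" "v < u" "u < x (Suc i)" for u v
        unfolding K_def
        using derivative_oscillation_le_L1_norm[OF assms(4,5)] that le by auto
    qed
    then show ?thesis
      by (simp add: step_def)
  qed
  have "midpoint_remainder f n x
      = (\<Sum>i<n. integral {x i..x (Suc i)} f - step x i * f ((x i + x (Suc i)) / 2))"
    using integral_division_sum[OF assms(6) int order_refl]
    by (simp add: midpoint_remainder_def midpoint_rule_def sum_subtractf)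
  also have "\<bar>\<dots>\<bar> \<le> (\<Sum>i<n. K * ((step x i)\<^sup>2 / 8))"
    using piece by (intro order_trans[OF sum_abs] sum_mono) auto
  finally show "\<bar>midpoint_remainder f n x\<bar>
      \<le> (LINT t:{a<..<b}|lebesgue. \<bar>f'' t\<bar>) * (\<Sum>i<n. (step x i)\<^sup>2 / 8)"
    by (simp add: K_def sum_distrib_left)
qed

end
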